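(* For all integers $n,k\geq 0$, \begin{align*} c_{13,1}\left(2^{3k+5}n+\frac{19\cdot 2^{3k+3}+9}{7}\right)&\equiv 0\pmod 2,\\ c_{13,1}\left(2^{3k+6}n+\frac{27\cdot 2^{3k+4}+9}{7}\right)&\equiv 0\pmod 2,\\ c_{13,1}\left(2^{3k+7}n+\frac{3\cdot 2^{3k+5}+9}{7}\right)&\equiv 0\pmod 2. \end{align*}
   Context: For complex $a,b$ the false theta function is $\Psi(a,b):=\sum_{n=0}^\infty a^{n(n+1)/2}b^{n(n-1)/2}-\sum_{n=-\infty}^{-1}a^{n(n+1)/2}b^{n(n-1)/2}$. For positive integers $r,s$, the integers $c_{r,s}(n)$ ($n\ge 0$) are defined by the power series identity $\sum_{n=0}^\infty c_{r,s}(n)q^n=\dfrac{1}{\Psi(-q^r,q^s)}$ (the denominator is a power series in $q$ with constant term $1$). *)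

theory Defs
  imports
    "HOL-Computational_Algebra.Formal_Power_Series"
    "HOL-Number_Theory.Cong"
begin

text \<open>
  The exponents \<open>n(n+1)/2\<close> and \<open>n(n-1)/2\<close> are nonnegative integers for every integer \<open>n\<close>, so
  neither \<open>div\<close> nor \<open>nat\<close> loses information.
\<close>

definition false_theta_term :: "'a::comm_ring_1 \<Rightarrow> 'a \<Rightarrow> int \<Rightarrow> 'a" where
  "false_theta_term a b n = a ^ nat (n * (n + 1) div 2) * b ^ nat (n * (n - 1) div 2)"

text \<open>
  The type class covers both complex numbers and formal power series. For the latter the sums
  converge in the \<open>X\<close>-adic topology of the type \<open>fps\<close>. The second sum runs over
  \<open>n = -1, -2, \<dots>\<close>.
\<close>

definition false_theta :: "'a::{comm_ring_1, topological_space} \<Rightarrow> 'a \<Rightarrow> 'a" where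
  "false_theta a b =
     (\<Sum>n. false_theta_term a b (int n)) - (\<Sum>m. false_theta_term a b (- int m - 1))"

text \<open>
  The description is well-defined for \<open>r, s > 0\<close>; see \<open>recip_false_theta_coeff_ex1\<close> below.
\<close>

definition recip_false_theta_coeff :: "nat \<Rightarrow> nat \<Rightarrow> nat \<Rightarrow> int" where
  "recip_false_theta_coeff r s =
     (THE c. Abs_fps c * false_theta (- (fps_X ^ r)) (fps_X ^ s) = 1)"

unbundle fps_syntax

lemma fps_sums_coeffwise:
  fixes f :: "nat \<Rightarrow> 'a::comm_ring_1 fps"
  assumes "\<And>i j. j < i \<Longrightarrow> f i $ j = 0"
  shows "f sums Abs_fps (\<lambda>j. \<Sum>i\<le>j. f i $ j)"
  unfolding sums_def
proof (rule tendsto_fpsI)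
  fix j
  have "(\<Sum>i<n. f i) $ j = (\<Sum>i\<le>j. f i $ j)" if "n > j" for n
    unfolding fps_sum_nth
    using that assms by (intro sum.mono_neutral_right) auto
  then show "\<forall>\<^sub>F n in sequentially. (\<Sum>i<n. f i) $ j = Abs_fps (\<lambda>j. \<Sum>i\<le>j. f i $ j) $ j"
    by (intro eventually_mono[OF eventually_gt_at_top[of j]]) simp
qed

lemma false_theta_term_fps:
  "false_theta_term (- (fps_X ^ r)) (fps_X ^ s :: 'a::comm_ring_1 fps) n =
     (- 1) ^ nat (n * (n + 1) div 2) *
     fps_X ^ (r * nat (n * (n + 1) div 2) + s * nat (n * (n - 1) div 2))"
  by (simp add: false_theta_term_def power_minus[of "fps_X ^ r"] power_add power_mult mult_ac)

lemma false_theta_term_fps_nth_eq_0: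
  assumes "j < r * nat (n * (n + 1) div 2) + s * nat (n * (n - 1) div 2)"
  shows "false_theta_term (- (fps_X ^ r)) (fps_X ^ s :: 'a::comm_ring_1 fps) n $ j = 0"
  unfolding false_theta_term_fps using assms
  by (cases "even (nat (n * (n + 1) div 2))") (simp_all add: fps_X_power_nth)

lemma false_theta_pos_terms:
  assumes "r > 0" "j < i"
  shows "false_theta_term (- (fps_X ^ r)) (fps_X ^ s :: 'a::comm_ring_1 fps) (int i) $ j = 0"
proof (rule false_theta_term_fps_nth_eq_0)
  have "int i * 2 \<le> int i * (int i + 1)"
    using assms by (intro mult_left_mono) auto
  then have "i \<le> nat (int i * (int i + 1) div 2)"
    by linarith
  also have "\<dots> \<le> r * nat (int i * (int i + 1) div 2)"
    using assms by simp
  finally show "j < r * nat (int i * (int i + 1) div 2) + s * nat (int i * (int i - 1) div 2)"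
    using assms by linarith
qed

lemma false_theta_neg_terms:
  assumes "s > 0" "j \<le> i"
  shows "false_theta_term (- (fps_X ^ r)) (fps_X ^ s :: 'a::comm_ring_1 fps) (- int i - 1) $ j = 0"
proof (rule false_theta_term_fps_nth_eq_0)
  define e where "e = (- int i - 1) * ((- int i - 1) - 1) div 2"
  have "(int i + 1) * 2 \<le> (int i + 1) * (int i + 2)"
    by (intro mult_left_mono) auto
  then have "(int i + 1) * 2 \<le> (- int i - 1) * ((- int i - 1) - 1)"
    by (simp add: algebra_simps)
  then have "(int i + 1) * 2 div 2 \<le> e"
    unfolding e_def by (intro zdiv_mono1) simp_all
  then have "i + 1 \<le> nat e"
    by simp
  also have "\<dots> \<le> s * nat e"
    using assms by simp
  finally show "j < r * nat ((- int i - 1) * ((- int i - 1) + 1) div 2) +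
                  s * nat ((- int i - 1) * ((- int i - 1) - 1) div 2)"
    using assms unfolding e_def by linarith
qed

lemma false_theta_fps_sums:
  fixes r s :: nat
  defines "t \<equiv> false_theta_term (- (fps_X ^ r)) (fps_X ^ s :: 'a::comm_ring_1 fps)"
  assumes "r > 0" "s > 0"
  shows "(\<lambda>n. t (int n)) sums Abs_fps (\<lambda>j. \<Sum>n\<le>j. t (int n) $ j)"
    and "(\<lambda>m. t (- int m - 1)) sums Abs_fps (\<lambda>j. \<Sum>m\<le>j. t (- int m - 1) $ j)"
  unfolding t_def
  by (rule fps_sums_coeffwise, rule false_theta_pos_terms, use assms in simp_all)
     (rule fps_sums_coeffwise, rule false_theta_neg_terms, use assms in simp_all)

lemma false_theta_fps_nth_0:
  assumes "r > 0" "s > 0"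
  shows "false_theta (- (fps_X ^ r)) (fps_X ^ s :: 'a::comm_ring_1 fps) $ 0 = 1"
proof -
  let ?t = "false_theta_term (- (fps_X ^ r)) (fps_X ^ s :: 'a fps)"
  note sums = false_theta_fps_sums[OF assms, where 'a = 'a]
  have "(\<Sum>n. ?t (int n)) $ 0 = ?t 0 $ 0"
    by (simp add: sums_unique[OF sums(1), symmetric])
  moreover have "(\<Sum>m. ?t (- int m - 1)) $ 0 = ?t (- 1) $ 0"
    by (simp add: sums_unique[OF sums(2), symmetric])
  moreover have "?t (- 1) $ 0 = 0"
    using false_theta_neg_terms[of s 0 0 r, where 'a = 'a] assms by simp
  ultimately show ?thesis
    by (simp add: false_theta_def false_theta_term_def)
qed

lemma recip_false_theta_coeff_ex1:
  assumes "r > 0" "s > 0"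
  shows "\<exists>!c. Abs_fps c * (false_theta (- (fps_X ^ r)) (fps_X ^ s) :: int fps) = 1"
proof -
  define P where "P = (false_theta (- (fps_X ^ r)) (fps_X ^ s) :: int fps)"
  have "P * fps_right_inverse P 1 = 1"
    using false_theta_fps_nth_0[OF assms, where 'a = int]
    by (intro fps_right_inverse) (simp add: P_def)
  then have ex: "Abs_fps (fps_nth (fps_right_inverse P 1)) * P = 1"
    by (simp add: fps_nth_inverse mult.commute)
  have "c = d" if "Abs_fps c * P = 1" "Abs_fps d * P = 1" for c d
  proof -
    have "Abs_fps c = Abs_fps d"
    proof -
      have "Abs_fps c = (Abs_fps d * P) * Abs_fps c"
        using that by simp
      also have "\<dots> = (Abs_fps c * P) * Abs_fps d"
        by (simp only: mult_ac)
      also have "\<dots> = Abs_fps d"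
        using that by simp
      finally show ?thesis .
    qed
    then show ?thesis
      by (simp add: fps_eq_iff fun_eq_iff)
  qed
  with ex show ?thesis
    unfolding P_def by blast
qed

lemma recip_false_theta_coeff:
  assumes "r > 0" "s > 0"
  shows "Abs_fps (recip_false_theta_coeff r s) * false_theta (- (fps_X ^ r)) (fps_X ^ s) = 1"
  unfolding recip_false_theta_coeff_def
  by (rule theI'[OF recip_false_theta_coeff_ex1[OF assms]])

lemma cong_pow_8: "[2 ^ (3 * k + d) = 2 ^ d] (mod (7::nat))"
proof -
  have "[(8::nat) ^ k = 1 ^ k] (mod 7)"
    by (rule cong_pow) (simp add: cong_def)
  then have "[8 ^ k * 2 ^ d = 1 ^ k * 2 ^ d] (mod (7::nat))"
    by (rule cong_mult) simp
  then show ?thesis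
    by (simp add: power_add power_mult)
qed

lemma seven_dvd_offsets:
  "(7::nat) dvd 19 * 2 ^ (3 * k + 3) + 9"
  "(7::nat) dvd 27 * 2 ^ (3 * k + 4) + 9"
  "(7::nat) dvd 3 * 2 ^ (3 * k + 5) + 9"
proof -
  have *: "7 dvd a * 2 ^ (3 * k + d) + 9" if "7 dvd a * 2 ^ d + (9::nat)" for a d
  proof -
    have "[a * 2 ^ (3 * k + d) + 9 = a * 2 ^ d + 9] (mod 7)"
      by (intro cong_add cong_mult cong_refl cong_pow_8)
    with that show ?thesis
      by (simp add: cong_dvd_iff)
  qed
  show "(7::nat) dvd 19 * 2 ^ (3 * k + 3) + 9"
    "(7::nat) dvd 27 * 2 ^ (3 * k + 4) + 9"
    "(7::nat) dvd 3 * 2 ^ (3 * k + 5) + 9"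
    by (rule *; simp)+
qed

unbundle no fps_syntax

end

theory Submission
  imports
    Defs
    "HOL-Computational_Algebra.Formal_Laurent_Series"
    "HOL-Library.Z2"
begin

text \<open>
  Modulo 2 the signs disappear, and with \<open>\<theta> a = \<Sum> q^(m^2)\<close>, the sum over all integers
  \<open>m \<equiv> a (mod 7)\<close>, completing the square gives \<open>\<Sum> c(N) q^(7N - 9) \<equiv> 1 / \<theta> 3\<close>. Let \<open>U\<close> send
  \<open>\<Sum> f(n) q^n\<close> to \<open>\<Sum> f(2n) q^n\<close>. In characteristic 2, \<open>U (f^2 g) = f U g\<close>, and moreover
  \<open>U (\<theta> 3) = (\<theta> 2)^2\<close> and \<open>U (\<theta> 2 \<theta> 3) = \<theta> 1 \<theta> 3\<close>. Writing \<open>1 / \<theta> 3 = \<theta> 3 / (\<theta> 3)^2\<close>, repeated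
  application of \<open>U\<close> to \<open>1 / \<theta> 3\<close> gives \<open>(\<theta> 2)^2 / \<theta> 3\<close>, \<open>(\<theta> 2)^3 / \<theta> 3\<close> and finally \<open>\<theta> 1 \<theta> 2\<close>.
  Hence \<open>c(N)\<close> is even whenever \<open>7N - 9 = 8L\<close> and \<open>L\<close> is not a sum of two squares, in particular
  if \<open>L = 2^i u\<close> with \<open>u \<equiv> 3 (mod 4)\<close>.
\<close>

unbundle fps_syntax

declare add_bit_eq_xor [simp del] mult_bit_eq_and [simp del]

section \<open>Sums of two squares\<close>

text \<open>Descent on \<open>i\<close>: squares are 0 or 1 modulo 4, and an even sum of two squares
  is twice the sum of the squares of \<open>(x + y) / 2\<close> and
  \<open>(x - y) / 2\<close>.\<close>

lemma not_sum_two_squares: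
  fixes x y w :: int
  shows "x\<^sup>2 + y\<^sup>2 \<noteq> 2 ^ i * (4 * w + 3)"
proof (induction i arbitrary: x y)
  case 0
  have sq: "z\<^sup>2 mod 4 = 0 \<or> z\<^sup>2 mod 4 = 1" for z :: int
  proof (cases "even z")
    case True
    then obtain t where "z = 2 * t" by blast
    then show ?thesis by (simp add: power2_eq_square)
  next
    case False
    then obtain t where t: "z = 2 * t + 1" by (rule oddE)
    have "z\<^sup>2 = 1 + 4 * (t * t + t)" by (simp add: t power2_eq_square algebra_simps)
    then show ?thesis by presburger
  qed
  show ?case using sq[of x] sq[of y] by simp presburger
next
  case (Suc i)
  show ?case
  proof
    assume eq: "x\<^sup>2 + y\<^sup>2 = 2 ^ Suc i * (4 * w + 3)"
    then have "even (x\<^sup>2 + y\<^sup>2)" by simp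
    then have "even (x + y)" "even (x - y)" by simp_all
    then obtain u v where uv: "x + y = 2 * u" "x - y = 2 * v" by blast
    then have "x = u + v" "y = u - v" by auto
    with eq have "2 * (u\<^sup>2 + v\<^sup>2) = 2 * (2 ^ i * (4 * w + 3))"
      by (simp add: power2_eq_square algebra_simps)
    then show False using Suc.IH[of u v] by simp
  qed
qed

section \<open>The operator \<open>U\<close> and squares of power series over
  \<open>bit\<close>\<close>

definition fps_even_part :: "'a fps \<Rightarrow> 'a fps" where
  "fps_even_part f = Abs_fps (\<lambda>n. f $ (2 * n))"

lemma fps_even_part_nth [simp]: "fps_even_part f $ n = f $ (2 * n)"
  by (simp add: fps_even_part_def)

text \<open>Frobenius, \<open>f(q)^2 = f(q^2)\<close>: the terms \<open>i\<close> and
  \<open>n - i\<close> of the convolution cancel in pairs, and only the diagonal term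
  \<open>i = n / 2\<close> is left.\<close>

lemma bit_fps_square_nth:
  fixes f :: "bit fps"
  shows "(f\<^sup>2) $ n = (if even n then f $ (n div 2) else 0)"
proof -
  define g where "g i = f $ i * f $ (n - i)" for i
  have "(f\<^sup>2) $ n = sum g {0..n}"
    by (simp add: power2_eq_square fps_mult_nth g_def)
  also have "{0..n} = {i. 2 * i < n} \<union> {i. i \<le> n \<and> 2 * i > n} \<union> {i. 2 * i = n}"
    by auto
  also have "sum g \<dots> = sum g {i. 2 * i < n} + sum g {i. i \<le> n \<and> 2 * i > n} + sum g {i. 2 * i = n}"
  proof -
    have fin: "finite {i. 2 * i < n}" "finite {i. i \<le> n \<and> 2 * i > n}" "finite {i. 2 * i = n}"
      by (auto intro: finite_subset[of _ "{..n}"])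
    have "sum g ({i. 2 * i < n} \<union> {i. i \<le> n \<and> 2 * i > n} \<union> {i. 2 * i = n}) =
        sum g ({i. 2 * i < n} \<union> {i. i \<le> n \<and> 2 * i > n}) + sum g {i. 2 * i = n}"
      by (rule sum.union_disjoint) (use fin in auto)
    also have "sum g ({i. 2 * i < n} \<union> {i. i \<le> n \<and> 2 * i > n}) =
        sum g {i. 2 * i < n} + sum g {i. i \<le> n \<and> 2 * i > n}"
      by (rule sum.union_disjoint) (use fin in auto)
    finally show ?thesis .
  qed
  also have "sum g {i. i \<le> n \<and> 2 * i > n} = sum g {i. 2 * i < n}"
    by (rule sum.reindex_bij_witness[of _ "\<lambda>i. n - i" "\<lambda>i. n - i"]) (auto simp: g_def mult.commute)
  also have "sum g {i. 2 * i = n} = (if even n then f $ (n div 2) else 0)"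
  proof (cases "even n")
    case True
    then have "{i. 2 * i = n} = {n div 2}" by auto
    with True show ?thesis
      \<comment> \<open>Every element of \<open>bit\<close> is its own square.\<close>
      by (cases "f $ (n div 2)") (auto simp: g_def elim!: evenE)
  next
    case False
    then have "{i. 2 * i = n} = {}" by auto
    with False show ?thesis by simp
  qed
  finally show ?thesis by simp
qed

text \<open>As a series in \<open>q^2\<close>, the factor \<open>f^2\<close> passes through
  \<open>U\<close> and becomes \<open>f\<close>.\<close>

lemma fps_even_part_square_mult:
  fixes f g :: "bit fps"
  shows "fps_even_part (f\<^sup>2 * g) = f * fps_even_part g"
proof (rule fps_ext)
  fix n
  have "fps_even_part (f\<^sup>2 * g) $ n = (\<Sum>i=0..2*n. (f\<^sup>2) $ i * g $ (2 * n - i))"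
    by (simp add: fps_mult_nth)
  also have "\<dots> = (\<Sum>i\<in>(\<lambda>i. 2 * i) ` {0..n}. (f\<^sup>2) $ i * g $ (2 * n - i))"
    by (rule sum.mono_neutral_right) (auto simp: bit_fps_square_nth elim!: evenE)
  also have "\<dots> = (\<Sum>i=0..n. f $ i * g $ (2 * (n - i)))"
    by (subst sum.reindex) (auto simp: inj_on_def bit_fps_square_nth diff_mult_distrib2)
  finally show "fps_even_part (f\<^sup>2 * g) $ n = (f * fps_even_part g) $ n"
    by (simp add: fps_mult_nth)
qed

section \<open>Theta series of residue classes modulo 7\<close>

definition residue_squares :: "int \<Rightarrow> nat \<Rightarrow> int set" where
  "residue_squares a n = {m. [m = a] (mod 7) \<and> m\<^sup>2 = int n}"

text \<open>This is \<open>\<theta> a\<close> reduced modulo 2. With cardinalities as coefficients,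
  identities between series come down to bijections.\<close>

definition residue_theta :: "int \<Rightarrow> bit fps" where
  "residue_theta a = Abs_fps (\<lambda>n. of_nat (card (residue_squares a n)))"

lemma residue_theta_nth: "residue_theta a $ n = of_nat (card (residue_squares a n))"
  by (simp add: residue_theta_def)

lemma abs_le_of_power2_eq:
  fixes m :: int
  assumes "m\<^sup>2 = int n"
  shows "\<bar>m\<bar> \<le> int n"
proof -
  have "\<bar>m\<bar> \<le> \<bar>m\<bar>\<^sup>2"
    using self_le_power[of "\<bar>m\<bar>" 2] by (cases "m = 0") auto
  with assms show ?thesis by simp
qed

lemma finite_residue_squares: "finite (residue_squares a n)"
proof (rule finite_subset)
  show "residue_squares a n \<subseteq> {- int n..int n}"
  proof
    fix m assume "m \<in> residue_squares a n"
    then have "\<bar>m\<bar> \<le> int n" by (intro abs_le_of_power2_eq) (simp add: residue_squares_def)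
    then show "m \<in> {- int n..int n}" by auto
  qed
qed simp

text \<open>The pairs are sorted by \<open>i = x^2\<close>; each fibre is a product of two solution
  sets.\<close>

lemma residue_theta_mult_nth:
  "(residue_theta a * residue_theta b) $ n =
     of_nat (card {(x, y). [x = a] (mod 7) \<and> [y = b] (mod 7) \<and> x\<^sup>2 + y\<^sup>2 = int n})"
proof -
  let ?S = "\<lambda>i. residue_squares a i \<times> residue_squares b (n - i)"
  have "{(x, y). [x = a] (mod 7) \<and> [y = b] (mod 7) \<and> x\<^sup>2 + y\<^sup>2 = int n} = (\<Union>i\<in>{0..n}. ?S i)"
  proof (intro equalityI subsetI)
    fix p assume "p \<in> {(x, y). [x = a] (mod 7) \<and> [y = b] (mod 7) \<and> x\<^sup>2 + y\<^sup>2 = int n}"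
    then obtain x y where p: "p = (x, y)" "[x = a] (mod 7)" "[y = b] (mod 7)" "x\<^sup>2 + y\<^sup>2 = int n"
      by blast
    have "int (nat (x\<^sup>2)) = x\<^sup>2" "0 \<le> y\<^sup>2" by simp_all
    with p(4) have le: "nat (x\<^sup>2) \<le> n" and "y\<^sup>2 = int (n - nat (x\<^sup>2))" by linarith+
    with p have "nat (x\<^sup>2) \<in> {0..n}" "p \<in> ?S (nat (x\<^sup>2))"
      by (auto simp: residue_squares_def)
    then show "p \<in> (\<Union>i\<in>{0..n}. ?S i)" by blast
  qed (auto simp: residue_squares_def of_nat_diff)
  also have "card \<dots> = (\<Sum>i=0..n. card (?S i))"
    by (rule card_UN_disjoint) (simp_all add: finite_residue_squares, auto simp: residue_squares_def)
  finally show ?thesis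
    by (simp add: fps_mult_nth residue_theta_nth card_cartesian_product)
qed

text \<open>If \<open>m^2 = 2 * n\<close> then \<open>m\<close> is even and \<open>n\<close> is
  twice the square of \<open>m / 2\<close>. The sign in \<open>- 2 * m\<close> matches the classes:
  \<open>-2 * 2\<close> is 3 modulo 7.\<close>

lemma fps_even_part_theta3: "fps_even_part (residue_theta 3) = (residue_theta 2)\<^sup>2"
proof (rule fps_ext)
  fix n
  show "fps_even_part (residue_theta 3) $ n = ((residue_theta 2)\<^sup>2) $ n"
  proof (cases "even n")
    case True
    then obtain l where l: "n = 2 * l" by blast
    have "bij_betw (\<lambda>m. - 2 * m) (residue_squares 2 l) (residue_squares 3 (2 * n))"
    proof (rule bij_betw_byWitness[of _ "\<lambda>m. - (m div 2)"])
      show "(\<lambda>m. - 2 * m) ` residue_squares 2 l \<subseteq> residue_squares 3 (2 * n)"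
        by (auto simp: residue_squares_def l cong_def power_mult_distrib) presburger
      have ev: "even m" if "m \<in> residue_squares 3 (2 * n)" for m
      proof -
        have "even (m\<^sup>2)" using that by (simp add: residue_squares_def)
        then show ?thesis by simp
      qed
      then show "\<forall>m\<in>residue_squares 3 (2 * n). - 2 * - (m div 2) = m" by auto
      show "(\<lambda>m. - (m div 2)) ` residue_squares 3 (2 * n) \<subseteq> residue_squares 2 l"
      proof clarify
        fix m assume m: "m \<in> residue_squares 3 (2 * n)"
        then obtain t where t: "m = 2 * t" using ev by blast
        with m show "- (m div 2) \<in> residue_squares 2 l"
          by (simp add: residue_squares_def l cong_def power_mult_distrib) presburger
      qed
    qed auto
    then show ?thesis
      by (simp add: bit_fps_square_nth residue_theta_nth l bij_betw_same_card)
  next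
    case False
    have "residue_squares 3 (2 * n) = {}"
    proof (rule ccontr)
      assume "residue_squares 3 (2 * n) \<noteq> {}"
      then obtain m where m: "m\<^sup>2 = 2 * int n" by (auto simp: residue_squares_def)
      then have "even (m\<^sup>2)" by simp
      then obtain t where "m = 2 * t" by auto
      with m have "int n = 2 * t\<^sup>2" by (simp add: power_mult_distrib)
      then have "even (int n)" by simp
      with False show False by simp
    qed
    with False show ?thesis by (simp add: bit_fps_square_nth residue_theta_nth)
  qed
qed

text \<open>The bijection is multiplication of the Gaussian integer \<open>u + i v\<close> by
  \<open>-(1 + i)\<close>. It doubles norms and sends the class of \<open>1 + 3i\<close> to that of
  \<open>2 - 4i\<close>, which is \<open>2 + 3i\<close> modulo 7.\<close>

lemma fps_even_part_theta2_theta3: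
  "fps_even_part (residue_theta 2 * residue_theta 3) = residue_theta 1 * residue_theta 3"
proof (rule fps_ext)
  fix n
  let ?S = "{(x, y). [x = 1] (mod 7) \<and> [y = 3] (mod 7) \<and> x\<^sup>2 + y\<^sup>2 = int n}"
  let ?T = "{(x, y). [x = 2] (mod 7) \<and> [y = 3] (mod 7) \<and> x\<^sup>2 + y\<^sup>2 = int (2 * n)}"
  have "bij_betw (\<lambda>(u, v). (v - u, - (u + v))) ?S ?T"
  proof (rule bij_betw_byWitness[of _ "\<lambda>(x, y). (- ((x + y) div 2), (x - y) div 2)"])
    show "(\<lambda>(u, v). (v - u, - (u + v))) ` ?S \<subseteq> ?T"
    proof clarify
      fix u v :: int
      assume *: "[u = 1] (mod 7)" "[v = 3] (mod 7)" "u\<^sup>2 + v\<^sup>2 = int n"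
      obtain a b where "u = 1 + 7 * a" "v = 3 + 7 * b"
        using *(1,2)[THEN cong_sym] unfolding cong_iff_lin by (auto simp: mult.commute)
      then have "v - u = 2 + 7 * (b - a)" "- (u + v) = 3 + 7 * (- 1 - a - b)" by simp_all
      then have "[v - u = 2] (mod 7)" "[- (u + v) = 3] (mod 7)"
        by (simp_all only: cong_def mod_mult_self2)
      moreover have "(v - u)\<^sup>2 + (- (u + v))\<^sup>2 = int (2 * n)"
        using *(3) by (simp add: power2_eq_square algebra_simps)
      ultimately show "[v - u = 2] (mod 7) \<and> [- (u + v) = 3] (mod 7) \<and>
          (v - u)\<^sup>2 + (- (u + v))\<^sup>2 = int (2 * n)" by blast
    qed
    \<comment> \<open>A Gaussian integer of even norm is divisible by \<open>1 + i\<close>.\<close>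
    have "\<exists>u v. x = v - u \<and> y = - (u + v)" if "x\<^sup>2 + y\<^sup>2 = int (2 * n)" for x y
    proof -
      have "even (x\<^sup>2 + y\<^sup>2)" using that by simp
      then have "even (x + y)" by simp
      then obtain t where "x + y = 2 * t" by blast
      then have "x = (x + - t) - (- t) \<and> y = - ((- t) + (x + - t))" by simp
      then show ?thesis by blast
    qed
    note param = this
    show "\<forall>p\<in>?T. (\<lambda>(u, v). (v - u, - (u + v))) ((\<lambda>(x, y). (- ((x + y) div 2), (x - y) div 2)) p) = p"
    proof
      fix p assume "p \<in> ?T"
      then obtain x y where p: "p = (x, y)" "x\<^sup>2 + y\<^sup>2 = int (2 * n)" by blast
      from param[OF p(2)] obtain u v where uv: "x = v - u" "y = - (u + v)" by blast
      have "- ((x + y) div 2) = u" "(x - y) div 2 = v" by (simp_all add: uv)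
      with uv show "(\<lambda>(u, v). (v - u, - (u + v))) ((\<lambda>(x, y). (- ((x + y) div 2), (x - y) div 2)) p) = p"
        by (simp add: p(1))
    qed
    show "(\<lambda>(x, y). (- ((x + y) div 2), (x - y) div 2)) ` ?T \<subseteq> ?S"
    proof clarify
      fix x y :: int
      assume *: "[x = 2] (mod 7)" "[y = 3] (mod 7)" "x\<^sup>2 + y\<^sup>2 = int (2 * n)"
      from param[OF *(3)] obtain u v where uv: "x = v - u" "y = - (u + v)" by blast
      have half: "- ((x + y) div 2) = u" "(x - y) div 2 = v" by (simp_all add: uv)
      obtain a b where "v - u = 2 + 7 * a" "- (u + v) = 3 + 7 * b"
        using *(1,2)[THEN cong_sym] unfolding cong_iff_lin uv by (auto simp: mult.commute)
      \<comment> \<open>Adding and subtracting the two equations gives \<open>-2 * u\<close> and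
        \<open>-2 * v\<close>. Multiplying by 3, the inverse of -2 modulo 7, gives
        \<open>-6 * u\<close> and \<open>-6 * v\<close>, to which \<open>7 * u\<close> and
        \<open>7 * v\<close> are added.\<close>
      then have "u = 1 + 7 * (3 * a + 3 * b + u + 2)" "v = 3 + 7 * (3 * b - 3 * a + v)" by simp_all
      then have "[u = 1] (mod 7)" "[v = 3] (mod 7)"
        by (metis cong_def mod_mult_self2)+
      moreover have "u\<^sup>2 + v\<^sup>2 = int n"
        using *(3) by (simp add: uv power2_eq_square algebra_simps)
      ultimately show "[- ((x + y) div 2) = 1] (mod 7) \<and> [(x - y) div 2 = 3] (mod 7) \<and>
          (- ((x + y) div 2))\<^sup>2 + ((x - y) div 2)\<^sup>2 = int n" unfolding half by blast
    qed
  qed auto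
  then show "fps_even_part (residue_theta 2 * residue_theta 3) $ n =
      (residue_theta 1 * residue_theta 3) $ n"
    by (simp only: fps_even_part_nth residue_theta_mult_nth bij_betw_same_card)
qed

section \<open>Reduction of the false theta function modulo 2\<close>

lemma bit_of_int_eq_0_iff: "(of_int x :: bit) = 0 \<longleftrightarrow> even x"
proof (cases "even x")
  case True
  then show ?thesis by (auto elim!: evenE)
next
  case False
  then show ?thesis by (auto elim!: oddE)
qed

text \<open>Modulo 2 neither the signs of the terms nor the minus between the two sums matter, so
  the sums merge into one over all integers.\<close>

lemma false_theta_fps_nth_bit:
  fixes r s j :: nat
  defines "e \<equiv> \<lambda>n::int. r * nat (n * (n + 1) div 2) + s * nat (n * (n - 1) div 2)"
  assumes "r > 0" "s > 0"
  shows "of_int (false_theta (- (fps_X ^ r)) (fps_X ^ s :: int fps) $ j) =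
           (of_nat (card {n. e n = j}) :: bit)"
proof -
  let ?t = "false_theta_term (- (fps_X ^ r)) (fps_X ^ s :: int fps)"
  note sums = false_theta_fps_sums[OF assms(2,3), where 'a = int]
  have t: "(of_int (?t n $ j) :: bit) = of_bool (e n = j)" for n
    unfolding false_theta_term_fps e_def
    by (cases "even (nat (n * (n + 1) div 2))") (simp_all add: fps_X_power_nth)
  \<comment> \<open>Every solution lies in the window covered by the two truncated sums:
    \<open>0..j\<close> from the first, \<open>-j-1..-1\<close> from the second.\<close>
  have e: "n \<in> {- int j - 1..int j}" if "e n = j" for n
  proof (rule ccontr)
    assume n: "n \<notin> {- int j - 1..int j}"
    have "?t n $ j = 0"
    proof (cases "n \<ge> 0")
      case True
      then show ?thesis using n false_theta_pos_terms[OF assms(2), of j "nat n" s, where 'a = int]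
        by simp
    next
      case False
      then show ?thesis
        using n false_theta_neg_terms[OF assms(3), of j "nat (- n - 1)" r, where 'a = int]
        by (simp add: nat_le_iff)
    qed
    with t[of n] that show False by simp
  qed
  have "of_int (false_theta (- (fps_X ^ r)) (fps_X ^ s :: int fps) $ j) =
      (\<Sum>n\<le>j. of_bool (e (int n) = j)) + (\<Sum>n\<le>j. of_bool (e (- int n - 1) = j) :: bit)"
    by (simp add: false_theta_def sums_unique[OF sums(1), symmetric]
        sums_unique[OF sums(2), symmetric] t)
  also have "(\<Sum>n\<le>j. of_bool (e (int n) = j)) = (\<Sum>n\<in>{0..int j}. of_bool (e n = j) :: bit)"
    by (rule sum.reindex_bij_witness[of _ nat int]) auto
  also have "(\<Sum>n\<le>j. of_bool (e (- int n - 1) = j)) =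
      (\<Sum>n\<in>{- int j - 1..-1}. of_bool (e n = j) :: bit)"
    by (rule sum.reindex_bij_witness[of _ "\<lambda>n. nat (- n - 1)" "\<lambda>n. - int n - 1"]) auto
  also have "(\<Sum>n\<in>{0..int j}. of_bool (e n = j)) + \<dots> =
      (\<Sum>n\<in>{0..int j} \<union> {- int j - 1..-1}. of_bool (e n = j))"
    by (rule sum.union_disjoint[symmetric]) auto
  also have "{0..int j} \<union> {- int j - 1..-1} = {- int j - 1..int j}" by auto
  also have "(\<Sum>n\<in>{- int j - 1..int j}. of_bool (e n = j)) =
      (of_nat (card ({- int j - 1..int j} \<inter> {n. e n = j})) :: bit)"
    by (simp add: of_bool_def sum.If_cases)
  also have "{- int j - 1..int j} \<inter> {n. e n = j} = {n. e n = j}" using e by blast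
  finally show ?thesis .
qed

lemma false_theta_exponent_13_1:
  "int (13 * nat (n * (n + 1) div 2) + 1 * nat (n * (n - 1) div 2)) = 7 * n\<^sup>2 + 6 * n"
proof -
  have nn: "n * (n + 1) \<ge> 0" "n * (n - 1) \<ge> 0"
    by (auto simp: zero_le_mult_iff)
  obtain a where a: "n * (n + 1) = 2 * a" by (metis evenE even_mult_iff odd_even_add odd_one)
  have b: "n * (n - 1) = 2 * (a - n)" using a by (simp add: algebra_simps)
  have "2 * (7 * n\<^sup>2 + 6 * n) = 2 * (13 * a + (a - n))"
    using a by (simp add: algebra_simps power2_eq_square)
  then show ?thesis using nn unfolding a b by simp
qed

text \<open>Completing the square, \<open>7 * (7 * n^2 + 6 * n) + 9 = (7 * n + 3)^2\<close>, and
  \<open>7 * n + 3\<close> runs through the class of 3 modulo 7.\<close>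

lemma residue_theta3_eq:
  fixes P :: "bit fps"
  assumes "\<And>j. P $ j = of_nat (card {n. 7 * n\<^sup>2 + 6 * n = int j})"
  shows "residue_theta 3 = fps_X ^ 9 * (P oo fps_X ^ 7)"
proof (rule fps_ext)
  fix i
  have shift: "m \<in> residue_squares 3 i \<longleftrightarrow> (\<exists>n. m = 7 * n + 3 \<and> 7 * (7 * n\<^sup>2 + 6 * n) + 9 = int i)" for m
  proof -
    have "[m = 3] (mod 7) \<longleftrightarrow> (\<exists>n. m = 7 * n + 3)" unfolding cong_def by presburger
    moreover have "(7 * n + 3)\<^sup>2 = 7 * (7 * n\<^sup>2 + 6 * n) + 9" for n :: int
      by (simp add: power2_eq_square algebra_simps)
    ultimately show ?thesis unfolding residue_squares_def by auto
  qed
  have pos: "7 * n\<^sup>2 + 6 * n \<ge> 0" for n :: int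
  proof -
    \<comment> \<open>No integer lies strictly between the roots \<open>-6/7\<close> and 0.\<close>
    have "n * (7 * n + 6) \<ge> 0" by (auto simp: zero_le_mult_iff)
    then show ?thesis by (simp add: power2_eq_square algebra_simps)
  qed
  show "residue_theta 3 $ i = (fps_X ^ 9 * (P oo fps_X ^ 7)) $ i"
  proof (cases "i \<ge> 9 \<and> 7 dvd i - 9")
    case True
    then obtain j where j: "i = 7 * j + 9" by (metis dvdE le_add_diff_inverse2)
    have "7 * e + 9 = int i \<longleftrightarrow> e = int j" for e by (auto simp: j)
    note shift_j = shift[unfolded this]
    have "bij_betw (\<lambda>n. 7 * n + 3) {n. 7 * n\<^sup>2 + 6 * n = int j} (residue_squares 3 i)"
      by (auto simp: bij_betw_def inj_on_def shift_j)
    then have "card (residue_squares 3 i) = card {n. 7 * n\<^sup>2 + 6 * n = int j}"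
      by (simp add: bij_betw_same_card)
    then show ?thesis
      by (simp add: residue_theta_nth assms j fps_X_power_mult_nth fps_nth_compose_X_power)
  next
    case False
    have "residue_squares 3 i = {}"
    proof (rule ccontr)
      assume "residue_squares 3 i \<noteq> {}"
      then obtain n where n: "7 * (7 * n\<^sup>2 + 6 * n) + 9 = int i" using shift by blast
      moreover obtain j where "7 * n\<^sup>2 + 6 * n = int j" using pos nonneg_int_cases by blast
      ultimately have "i = 7 * j + 9" by simp
      with False show False by simp
    qed
    with False show ?thesis
      by (auto simp: residue_theta_nth fps_X_power_mult_nth fps_nth_compose_X_power)
  qed
qed

text \<open>The defining identity is reduced modulo 2, \<open>q^7\<close> is substituted for
  \<open>q\<close>, and \<open>q^9\<close> is multiplied in, so no negative exponents occur.\<close>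

lemma recip_theta3_bit:
  defines "C \<equiv> Abs_fps (\<lambda>n. of_int (recip_false_theta_coeff 13 1 n)) :: bit fps"
  shows "(C oo fps_X ^ 7) * residue_theta 3 = fps_X ^ 9"
proof -
  define \<Psi> where "\<Psi> = (false_theta (- (fps_X ^ 13)) (fps_X ^ 1) :: int fps)"
  define P where "P = (Abs_fps (\<lambda>n. of_int (\<Psi> $ n)) :: bit fps)"
  have P: "P $ j = of_nat (card {n. 7 * n\<^sup>2 + 6 * n = int j})" for j
  proof -
    have "P $ j = of_nat (card {n::int. 13 * nat (n * (n + 1) div 2) + 1 * nat (n * (n - 1) div 2) = j})"
      unfolding P_def \<Psi>_def by (simp only: fps_nth_Abs_fps) (rule false_theta_fps_nth_bit; simp)
    also have "{n::int. 13 * nat (n * (n + 1) div 2) + 1 * nat (n * (n - 1) div 2) = j} =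
        {n. 7 * n\<^sup>2 + 6 * n = int j}"
      unfolding false_theta_exponent_13_1[symmetric] of_nat_eq_iff ..
    finally show ?thesis .
  qed
  have "C * P = 1"
  proof (rule fps_ext)
    fix n
    have "(C * P) $ n = of_int ((Abs_fps (recip_false_theta_coeff 13 1) * \<Psi>) $ n)"
      by (simp add: C_def P_def fps_mult_nth)
    also have "Abs_fps (recip_false_theta_coeff 13 1) * \<Psi> = 1"
      unfolding \<Psi>_def by (rule recip_false_theta_coeff) simp_all
    finally show "(C * P) $ n = 1 $ n" by simp
  qed
  then have "(C oo fps_X ^ 7) * (P oo fps_X ^ 7) = 1"
    by (simp flip: fps_compose_mult_distrib)
  then show ?thesis
    unfolding residue_theta3_eq[OF P] by (metis mult.left_commute mult.right_neutral)
qed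

section \<open>Three applications of \<open>U\<close> and the congruences\<close>

text \<open>The factor \<open>q^16\<close> clears the pole of \<open>1 / \<theta> 3\<close> and stays a power of \<open>q\<close> under \<open>U\<close>.\<close>

lemma triple_even_part:
  assumes D: "D * residue_theta 3 = fps_X ^ 16"
  shows "fps_even_part (fps_even_part (fps_even_part D)) =
           fps_X\<^sup>2 * (residue_theta 1 * residue_theta 2)"
proof -
  let ?t1 = "residue_theta 1" and ?t2 = "residue_theta 2" and ?t3 = "residue_theta 3"
  define D1 where "D1 = fps_even_part D"
  define D2 where "D2 = fps_even_part D1"
  define D3 where "D3 = fps_even_part D2"
  \<comment> \<open>In fractions: \<open>E = F^2 * G / \<theta> 3 = F^2 * (G * \<theta> 3) /
    (\<theta> 3)^2\<close>, and both squares pass through \<open>U\<close>.\<close>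
  have step: "fps_even_part E * ?t3 = F * fps_even_part (G * ?t3)" if "E * ?t3 = F\<^sup>2 * G" for E F G
  proof -
    have "?t3\<^sup>2 * E = F\<^sup>2 * (G * ?t3)"
      using that by (simp add: power2_eq_square mult_ac)
    then show ?thesis
      by (metis fps_even_part_square_mult mult.commute)
  qed
  have "D * ?t3 = (fps_X ^ 8)\<^sup>2 * 1" using D by simp
  from step[OF this] have "D1 * ?t3 = (fps_X ^ 4 * ?t2)\<^sup>2 * 1"
    by (simp add: D1_def fps_even_part_theta3 power_mult_distrib)
  from step[OF this] have "D2 * ?t3 = fps_X ^ 4 * ?t2 * ?t2\<^sup>2"
    by (simp only: D2_def fps_even_part_theta3 mult_1_left)
  \<comment> \<open>Only a square can leave \<open>U\<close>, so one factor
    \<open>\<theta> 2\<close> of the cube stays behind as \<open>G\<close>.\<close>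
  also have "\<dots> = (fps_X\<^sup>2 * ?t2)\<^sup>2 * ?t2"
    by (simp add: power_mult_distrib mult_ac flip: power_mult)
  finally have "D2 * ?t3 = (fps_X\<^sup>2 * ?t2)\<^sup>2 * ?t2" .
  from step[OF this] have "D3 * ?t3 = fps_X\<^sup>2 * (?t1 * ?t2) * ?t3"
    by (simp add: D3_def fps_even_part_theta2_theta3 mult_ac)
  moreover have "?t3 \<noteq> 0" using D by auto
  ultimately show ?thesis by (simp add: D1_def D2_def D3_def)
qed

text \<open>The coefficient is read off at \<open>7 * N + 7 = 8 * (L + 2)\<close>, where
  \<open>L\<close> is not a sum of two squares.\<close>

lemma recip_false_theta_coeff_13_1_even:
  assumes N: "7 * N = 8 * (2 ^ i * (4 * w + 3)) + 9"
  shows "[recip_false_theta_coeff 13 1 N = 0] (mod 2)"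
proof -
  define C where "C = (Abs_fps (\<lambda>n. of_int (recip_false_theta_coeff 13 1 n)) :: bit fps)"
  \<comment> \<open>The shift by 7 raises \<open>q^9\<close> to the required
    \<open>q^16\<close>.\<close>
  define D where "D = fps_X ^ 7 * (C oo fps_X ^ 7)"
  define L where "L = 2 ^ i * (4 * w + 3)"
  have "D * residue_theta 3 = fps_X ^ 7 * fps_X ^ 9"
    unfolding D_def C_def by (simp only: mult.assoc recip_theta3_bit)
  then have "fps_even_part (fps_even_part (fps_even_part D)) =
      fps_X\<^sup>2 * (residue_theta 1 * residue_theta 2)"
    by (intro triple_even_part) (simp flip: power_add)
  then have "D $ (8 * (L + 2)) = (fps_X\<^sup>2 * (residue_theta 1 * residue_theta 2)) $ (L + 2)"
    by (auto simp: fps_eq_iff dest: spec[of _ "L + 2"])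
  also have "\<dots> = (residue_theta 1 * residue_theta 2) $ L"
    by (simp add: fps_X_power_mult_nth)
  also have "\<dots> = 0"
  proof -
    have "int L = 2 ^ i * (4 * int w + 3)" by (simp add: L_def)
    then show ?thesis using not_sum_two_squares[of _ _ i "int w"]
      by (simp add: residue_theta_mult_nth)
  qed
  also have "8 * (L + 2) = 7 * N + 7" using N by (simp add: L_def)
  finally have "C $ N = 0"
    by (simp add: D_def fps_X_power_mult_nth fps_nth_compose_X_power)
  then show ?thesis
    by (simp add: C_def bit_of_int_eq_0_iff cong_0_iff)
qed

theorem theorem4p1:
  fixes n k :: nat
  shows "[recip_false_theta_coeff 13 1
            (2 ^ (3 * k + 5) * n + (19 * 2 ^ (3 * k + 3) + 9) div 7) = 0] (mod 2) \<and>
         [recip_false_theta_coeff 13 1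
            (2 ^ (3 * k + 6) * n + (27 * 2 ^ (3 * k + 4) + 9) div 7) = 0] (mod 2) \<and>
         [recip_false_theta_coeff 13 1
            (2 ^ (3 * k + 7) * n + (3 * 2 ^ (3 * k + 5) + 9) div 7) = 0] (mod 2)"
proof (intro conjI)
  show "[recip_false_theta_coeff 13 1
      (2 ^ (3 * k + 5) * n + (19 * 2 ^ (3 * k + 3) + 9) div 7) = 0] (mod 2)"
    \<comment> \<open>In the three cases \<open>7 * N - 9\<close> is \<open>8 * 2 ^ i\<close> times
      \<open>28 * n + 19\<close>, \<open>28 * n + 27\<close> and \<open>28 * n + 3\<close>, each of
      the form \<open>4 * w + 3\<close>.\<close>
    by (rule recip_false_theta_coeff_13_1_even[of _ "3 * k" "7 * n + 4"],
        simp only: distrib_left dvd_mult_div_cancel[OF seven_dvd_offsets(1)])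
      (simp add: power_add algebra_simps)
  show "[recip_false_theta_coeff 13 1
      (2 ^ (3 * k + 6) * n + (27 * 2 ^ (3 * k + 4) + 9) div 7) = 0] (mod 2)"
    by (rule recip_false_theta_coeff_13_1_even[of _ "3 * k + 1" "7 * n + 6"],
        simp only: distrib_left dvd_mult_div_cancel[OF seven_dvd_offsets(2)])
      (simp add: power_add algebra_simps)
  show "[recip_false_theta_coeff 13 1
      (2 ^ (3 * k + 7) * n + (3 * 2 ^ (3 * k + 5) + 9) div 7) = 0] (mod 2)"
    by (rule recip_false_theta_coeff_13_1_even[of _ "3 * k + 2" "7 * n"],
        simp only: distrib_left dvd_mult_div_cancel[OF seven_dvd_offsets(3)])
      (simp add: power_add algebra_simps)
qed

unbundle no fps_syntax

end
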